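(* Let $\mathbb{T}$ be a time scale, $a,b\in\mathbb{T}$ and $\alpha\in(0,1]$. Let $f:[a,b]\to\mathbb{R}$ be a continuous convex function and let $w:\mathbb{T}\to\mathbb{R}$ be a continuous function such that $w(t)\ge0$ for all $t\in\mathbb{T}$ and $\int_a^b w(t)\,\Delta^\alpha t>0$. Then $$f(x_{w,\alpha})\le\frac{1}{\int_a^b w(t)\,\Delta^\alpha t}\int_a^b f(t)w(t)\,\Delta^\alpha t\le\frac{b-x_{w,\alpha}}{b-a}f(a)+\frac{x_{w,\alpha}-a}{b-a}f(b),$$ where $$x_{w,\alpha}=\frac{\int_a^b t\,w(t)\,\Delta^\alpha t}{\int_a^b w(t)\,\Delta^\alpha t}.$$
   Context: A time scale $\mathbb{T}$ is a nonempty closed subset of $\mathbb{R}$. Here $[a,b]$ is the real interval with endpoints $a$ and $b$. The $\alpha$-fractional integral of a function $f$ is $\int f(t)\,\Delta^\alpha t:=\int f(t)\,t^{\alpha-1}\,\Delta t$, where the right-hand side is the usual (indefinite) Hilger delta-integral on $\mathbb{T}$. Writing $F_\alpha(t)=\int f(t)\,\Delta^\alpha t$, the Cauchy $\alpha$-fractional integral is $\int_a^b f(t)\,\Delta^\alpha t:=F_\alpha(b)-F_\alpha(a)$ for $a,b\in\mathbb{T}$. *)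

theory Defs
  imports "HOL-Analysis.Analysis"
begin

definition time_scale :: "real set \<Rightarrow> bool" where
  "time_scale T \<longleftrightarrow> closed T \<and> T \<noteq> {}"

text \<open>Jump operators, with the usual conventions that the forward jump of a maximum and the
  backward jump of a minimum is the point itself.\<close>

definition fwd_jump :: "real set \<Rightarrow> real \<Rightarrow> real" where
  "fwd_jump T t = (if \<exists>s\<in>T. t < s then Inf {s \<in> T. t < s} else t)"

definition bwd_jump :: "real set \<Rightarrow> real \<Rightarrow> real" where
  "bwd_jump T t = (if \<exists>s\<in>T. s < t then Sup {s \<in> T. s < t} else t)"

definition right_scattered :: "real set \<Rightarrow> real \<Rightarrow> bool" where
  "right_scattered T t \<longleftrightarrow> t < fwd_jump T t"

definition left_scattered :: "real set \<Rightarrow> real \<Rightarrow> bool" where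
  "left_scattered T t \<longleftrightarrow> bwd_jump T t < t"

text \<open>The set \<open>T\<^sup>\<kappa>\<close>: the time scale without its maximum, if that is left-scattered.\<close>

definition kappa :: "real set \<Rightarrow> real set" where
  "kappa T = T - {M. (\<forall>s\<in>T. s \<le> M) \<and> left_scattered T M}"

definition has_delta_derivative :: "(real \<Rightarrow> real) \<Rightarrow> real \<Rightarrow> real set \<Rightarrow> real \<Rightarrow> bool" where
  "has_delta_derivative F d T t \<longleftrightarrow>
     (\<forall>\<epsilon>>0. \<exists>\<delta>>0. \<forall>s\<in>T. \<bar>s - t\<bar> < \<delta> \<longrightarrow>
        \<bar>F (fwd_jump T t) - F s - d * (fwd_jump T t - s)\<bar> \<le> \<epsilon> * \<bar>fwd_jump T t - s\<bar>)"

text \<open>Hilger's pre-antiderivative: \<open>F\<close> is continuous and has delta derivative \<open>f\<close> on a region of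
  differentiation \<open>D\<close>, whose complement is countable and free of right-scattered points.
  Regulatedness of \<open>f\<close>, under which existence is usually proved, is not required: integrands such
  as \<open>t powr (\<alpha> - 1)\<close> near \<open>0\<close> are not regulated but may still have a pre-antiderivative.\<close>

definition pre_antiderivative :: "real set \<Rightarrow> (real \<Rightarrow> real) \<Rightarrow> (real \<Rightarrow> real) \<Rightarrow> bool" where
  "pre_antiderivative T f F \<longleftrightarrow>
     continuous_on T F \<and>
     (\<exists>D \<subseteq> kappa T. countable (kappa T - D) \<and>
        (\<forall>t \<in> kappa T - D. \<not> right_scattered T t) \<and>
        (\<forall>t \<in> D. has_delta_derivative F (f t) T t))"

text \<open>The Cauchy integral \<open>F b - F a\<close>, for \<open>a\<close>, \<open>b\<close> in \<open>T\<close>. Only the part of \<open>T\<close> between the limits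
  is used, as integrands need not be defined elsewhere. A pre-antiderivative on all of \<open>T\<close>
  restricts to one there: the endpoints, where the jump operators may change, are
  right-dense if they need to be moved to the exceptional set. As for the library's
  integrals, the value is \<open>0\<close> if there is no pre-antiderivative.\<close>

definition delta_integral :: "real set \<Rightarrow> real \<Rightarrow> real \<Rightarrow> (real \<Rightarrow> real) \<Rightarrow> real" where
  "delta_integral T a b f =
     (let P = pre_antiderivative (T \<inter> {min a b..max a b}) f in
      if \<exists>F. P F then (SOME F. P F) b - (SOME F. P F) a else 0)"

text \<open>The weight \<open>t\<^bsup>\<alpha>-1\<^esup>\<close>. The case \<open>\<alpha> = 1\<close> is separate since \<open>0 powr 0 = 0\<close>, whereas for \<open>\<alpha> = 1\<close>
  the fractional integral must be the plain delta integral also at \<open>t = 0\<close>. For \<open>\<alpha> < 1\<close> and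
  \<open>t \<le> 0\<close>, where the real power has no standard meaning, \<open>powr\<close> gives \<open>\<bar>t\<bar> powr (\<alpha> - 1)\<close>,
  and \<open>0\<close> at \<open>t = 0\<close>.\<close>

definition frac_weight :: "real \<Rightarrow> real \<Rightarrow> real" where
  "frac_weight \<alpha> t = (if \<alpha> = 1 then 1 else t powr (\<alpha> - 1))"

definition frac_integral :: "real set \<Rightarrow> real \<Rightarrow> real \<Rightarrow> real \<Rightarrow> (real \<Rightarrow> real) \<Rightarrow> real" where
  "frac_integral T \<alpha> a b f = delta_integral T a b (\<lambda>t. f t * frac_weight \<alpha> t)"

end

theory Submission
  imports Defs
begin

text \<open>
  Put \<open>g t = w t * t\<^bsup>\<alpha>-1\<^esup>\<close>, which is nonnegative, and let \<open>S\<close> be the part of the time scale in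
  \<open>[a, b]\<close>. Once the three integrals are known to be linear and monotone in the integrand, the
  theorem is Jensen's inequality and its converse. The mean \<open>x\<close> lies in \<open>[a, b]\<close>; integrating an
  affine minorant of \<open>f\<close> that is almost exact at \<open>x\<close> against \<open>g\<close> gives the lower bound, and
  integrating the chord of \<open>f\<close> over \<open>[a, b]\<close>, which majorises \<open>f\<close>, gives the upper bound.

  Two facts about pre-antiderivatives are behind this. First, a pre-antiderivative of a nonnegative
  function is nondecreasing (\<open>pre_antiderivative_mono\<close>), in spite of the countable exceptional
  set. Hence the integral does not depend on the chosen pre-antiderivative and is monotone; also,
  a positive integral of \<open>w\<close> forces \<open>a < b\<close>.

  Second, the integrals of \<open>t w(t)\<close> and \<open>f(t) w(t)\<close> exist as soon as the one of \<open>w\<close> does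
  (\<open>pre_antiderivative_times_continuous\<close>); existence is not automatic, because \<open>g\<close> may be
  unbounded near \<open>0\<close>. If \<open>G\<close> is a pre-antiderivative of \<open>g\<close>, then \<open>f g\<close> should integrate to the
  Stieltjes integral of \<open>f\<close> with respect to \<open>G\<close>. Substituting \<open>u = G t\<close> makes this an ordinary
  integral over a real interval, of \<open>f\<close> composed with a generalised inverse of \<open>G\<close>. That function
  is bounded and measurable, and its indefinite integral inherits from \<open>G\<close> both continuity and
  the points of delta differentiability.
\<close>

section \<open>Forward jumps\<close>

lemma fwd_jump_greater:
  assumes "closed S" "s \<in> S" "t < s"
  shows "fwd_jump S t \<in> S" "t \<le> fwd_jump S t" "fwd_jump S t \<le> s"
proof -
  let ?A = "{r \<in> S. t < r}"
  have eq: "fwd_jump S t = Inf ?A"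
    using assms by (auto simp: fwd_jump_def)
  have bdd: "bdd_below ?A" by (rule bdd_belowI[of _ t]) auto
  have "Inf ?A \<in> closure ?A"
    using assms bdd by (intro closure_contains_Inf) auto
  also have "closure ?A \<subseteq> S"
    using \<open>closed S\<close> by (intro closure_minimal) auto
  finally show "fwd_jump S t \<in> S" by (simp add: eq)
  show "t \<le> fwd_jump S t"
    unfolding eq using assms by (intro cInf_greatest) auto
  show "fwd_jump S t \<le> s"
    unfolding eq using assms bdd by (intro cInf_lower) auto
qed

lemma fwd_jump_ge: "closed S \<Longrightarrow> t \<le> fwd_jump S t"
  by (cases "\<exists>s\<in>S. t < s") (metis fwd_jump_greater(2), simp add: fwd_jump_def)

lemma fwd_jump_in: "closed S \<Longrightarrow> t \<in> S \<Longrightarrow> fwd_jump S t \<in> S"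
  by (cases "\<exists>s\<in>S. t < s") (metis fwd_jump_greater(1), simp add: fwd_jump_def)

lemma right_dense_approx:
  assumes "closed S" "s \<in> S" "t < s" "\<not> right_scattered S t" "0 < e"
  obtains r where "r \<in> S" "t < r" "r < t + e" "r \<le> s"
proof -
  have "fwd_jump S t = t"
    using assms fwd_jump_greater(2)[of S s t] by (auto simp: right_scattered_def)
  then have "Inf {r \<in> S. t < r} < t + e"
    using assms by (auto simp: fwd_jump_def split: if_splits)
  then obtain r where r: "r \<in> S" "t < r" "r < t + e"
    using assms by (subst (asm) cInf_less_iff) (auto intro: bdd_belowI[of _ t])
  show thesis
  proof (cases "r \<le> s")
    case True
    with r show ?thesis by (rule that)
  next
    case False
    with r assms show ?thesis by (intro that[of s]) auto
  qed
qed

lemma kappa_if_not_max: "t \<in> S \<Longrightarrow> s \<in> S \<Longrightarrow> t < s \<Longrightarrow> t \<in> kappa S"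
  by (force simp: kappa_def)

section \<open>Linear combinations of pre-antiderivatives\<close>

lemma has_delta_derivative_cmult:
  assumes "has_delta_derivative F d S t"
  shows "has_delta_derivative (\<lambda>t. c * F t) (c * d) S t"
  unfolding has_delta_derivative_def
proof (intro allI impI)
  fix e :: real assume "0 < e"
  then have "0 < e / (\<bar>c\<bar> + 1)" by simp
  then obtain \<delta> where \<delta>: "0 < \<delta>"
    "\<And>s. s \<in> S \<Longrightarrow> \<bar>s - t\<bar> < \<delta> \<Longrightarrow> \<bar>F (fwd_jump S t) - F s - d * (fwd_jump S t - s)\<bar>
        \<le> e / (\<bar>c\<bar> + 1) * \<bar>fwd_jump S t - s\<bar>"
    using assms unfolding has_delta_derivative_def by meson
  show "\<exists>\<delta>>0. \<forall>s\<in>S. \<bar>s - t\<bar> < \<delta> \<longrightarrow>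
      \<bar>c * F (fwd_jump S t) - c * F s - c * d * (fwd_jump S t - s)\<bar> \<le> e * \<bar>fwd_jump S t - s\<bar>"
  proof (intro exI conjI ballI impI)
    fix s assume s: "s \<in> S" "\<bar>s - t\<bar> < \<delta>"
    have "\<bar>c * F (fwd_jump S t) - c * F s - c * d * (fwd_jump S t - s)\<bar>
        = \<bar>c\<bar> * \<bar>F (fwd_jump S t) - F s - d * (fwd_jump S t - s)\<bar>"
      by (simp add: abs_mult[symmetric] algebra_simps)
    also have "\<dots> \<le> \<bar>c\<bar> * (e / (\<bar>c\<bar> + 1) * \<bar>fwd_jump S t - s\<bar>)"
      using \<delta>(2)[OF s] by (intro mult_left_mono) auto
    also have "\<dots> = (\<bar>c\<bar> / (\<bar>c\<bar> + 1)) * (e * \<bar>fwd_jump S t - s\<bar>)"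
      by simp
    also have "\<dots> \<le> 1 * (e * \<bar>fwd_jump S t - s\<bar>)"
      using \<open>0 < e\<close> by (intro mult_right_mono) auto
    finally show "\<bar>c * F (fwd_jump S t) - c * F s - c * d * (fwd_jump S t - s)\<bar>
        \<le> e * \<bar>fwd_jump S t - s\<bar>" by simp
  qed (fact \<delta>(1))
qed

lemma has_delta_derivative_add:
  assumes "has_delta_derivative F d S t" "has_delta_derivative G d' S t"
  shows "has_delta_derivative (\<lambda>t. F t + G t) (d + d') S t"
  unfolding has_delta_derivative_def
proof (intro allI impI)
  fix e :: real assume "0 < e"
  then have "0 < e / 2" by simp
  obtain \<delta> where \<delta>: "0 < \<delta>"
    "\<And>s. s \<in> S \<Longrightarrow> \<bar>s - t\<bar> < \<delta> \<Longrightarrow> \<bar>F (fwd_jump S t) - F s - d * (fwd_jump S t - s)\<bar>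
        \<le> e / 2 * \<bar>fwd_jump S t - s\<bar>"
    using assms(1) \<open>0 < e / 2\<close> unfolding has_delta_derivative_def by meson
  obtain \<delta>' where \<delta>': "0 < \<delta>'"
    "\<And>s. s \<in> S \<Longrightarrow> \<bar>s - t\<bar> < \<delta>' \<Longrightarrow> \<bar>G (fwd_jump S t) - G s - d' * (fwd_jump S t - s)\<bar>
        \<le> e / 2 * \<bar>fwd_jump S t - s\<bar>"
    using assms(2) \<open>0 < e / 2\<close> unfolding has_delta_derivative_def by meson
  show "\<exists>\<delta>>0. \<forall>s\<in>S. \<bar>s - t\<bar> < \<delta> \<longrightarrow>
      \<bar>F (fwd_jump S t) + G (fwd_jump S t) - (F s + G s) - (d + d') * (fwd_jump S t - s)\<bar>
        \<le> e * \<bar>fwd_jump S t - s\<bar>"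
  proof (intro exI conjI ballI impI)
    fix s assume s: "s \<in> S" "\<bar>s - t\<bar> < min \<delta> \<delta>'"
    let ?x = "F (fwd_jump S t) - F s - d * (fwd_jump S t - s)"
    let ?y = "G (fwd_jump S t) - G s - d' * (fwd_jump S t - s)"
    have "F (fwd_jump S t) + G (fwd_jump S t) - (F s + G s) - (d + d') * (fwd_jump S t - s)
        = ?x + ?y"
      by (simp add: algebra_simps)
    moreover have "\<bar>?x + ?y\<bar> \<le> \<bar>?x\<bar> + \<bar>?y\<bar>" by (rule abs_triangle_ineq)
    moreover have "\<bar>?x\<bar> \<le> e / 2 * \<bar>fwd_jump S t - s\<bar>" "\<bar>?y\<bar> \<le> e / 2 * \<bar>fwd_jump S t - s\<bar>"
      using \<delta>(2)[of s] \<delta>'(2)[of s] s by auto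
    ultimately show
      "\<bar>F (fwd_jump S t) + G (fwd_jump S t) - (F s + G s) - (d + d') * (fwd_jump S t - s)\<bar>
        \<le> e * \<bar>fwd_jump S t - s\<bar>" by linarith
  qed (use \<delta> \<delta>' in simp)
qed

lemma pre_antiderivative_lincomb:
  assumes "pre_antiderivative S f F" "pre_antiderivative S g G"
  shows "pre_antiderivative S (\<lambda>t. c * f t + d * g t) (\<lambda>t. c * F t + d * G t)"
proof -
  obtain D where D: "continuous_on S F" "D \<subseteq> kappa S" "countable (kappa S - D)"
    "\<forall>t\<in>kappa S - D. \<not> right_scattered S t" "\<forall>t\<in>D. has_delta_derivative F (f t) S t"
    using assms(1) by (auto simp: pre_antiderivative_def)
  obtain D' where D': "continuous_on S G" "D' \<subseteq> kappa S" "countable (kappa S - D')"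
    "\<forall>t\<in>kappa S - D'. \<not> right_scattered S t" "\<forall>t\<in>D'. has_delta_derivative G (g t) S t"
    using assms(2) by (auto simp: pre_antiderivative_def)
  show ?thesis
    unfolding pre_antiderivative_def
  proof (intro conjI exI)
    show "continuous_on S (\<lambda>t. c * F t + d * G t)"
      using D D' by (intro continuous_intros)
    show "countable (kappa S - (D \<inter> D'))"
      using D D' by (simp add: Diff_Int)
    show "\<forall>t\<in>D \<inter> D'. has_delta_derivative (\<lambda>t. c * F t + d * G t) (c * f t + d * g t) S t"
      using D(5) D'(5) by (intro ballI has_delta_derivative_add has_delta_derivative_cmult) auto
  qed (use D D' in auto)
qed

section \<open>Monotonicity and uniqueness of the integral\<close>

text \<open>The definition of the derivative is centred at the forward jump; at a right-scattered point
  this jump itself, and at a right-dense point every close enough point to the right, witnesses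
  that a function with nonnegative derivative does not drop faster than any given rate.\<close>

lemma has_delta_derivative_nonneg_step:
  assumes "closed S" "s \<in> S" "t \<in> S" "t < s" "has_delta_derivative F d S t" "0 \<le> d" "0 < e"
  obtains r where "r \<in> S" "t < r" "r \<le> s" "F t - e * (r - t) \<le> F r"
proof -
  obtain \<delta> where \<delta>: "0 < \<delta>"
    "\<And>s. s \<in> S \<Longrightarrow> \<bar>s - t\<bar> < \<delta> \<Longrightarrow> \<bar>F (fwd_jump S t) - F s - d * (fwd_jump S t - s)\<bar>
        \<le> e * \<bar>fwd_jump S t - s\<bar>"
    using assms(5,7) unfolding has_delta_derivative_def by meson
  show thesis
  proof (cases "right_scattered S t")
    case True
    let ?r = "fwd_jump S t"
    have "t < ?r" using True by (simp add: right_scattered_def)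
    moreover have "\<bar>F ?r - F t - d * (?r - t)\<bar> \<le> e * \<bar>?r - t\<bar>"
      using \<delta> assms by simp
    moreover have "0 \<le> d * (?r - t)" using assms \<open>t < ?r\<close> by simp
    ultimately have "F t - e * (?r - t) \<le> F ?r" by simp
    then show ?thesis
      using assms fwd_jump_greater[of S s t] \<open>t < ?r\<close> by (intro that[of ?r]) auto
  next
    case False
    then have jump: "fwd_jump S t = t"
      using assms fwd_jump_ge[of S t] by (simp add: right_scattered_def)
    obtain r where r: "r \<in> S" "t < r" "r < t + \<delta>" "r \<le> s"
      using right_dense_approx[OF assms(1,2,4) False \<delta>(1)] by blast
    have "\<bar>F t - F r - d * (t - r)\<bar> \<le> e * \<bar>t - r\<bar>"
      using \<delta>(2)[of r] r by (simp add: jump)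
    moreover have "0 \<le> d * (r - t)" using assms r by simp
    moreover have "d * (t - r) = - (d * (r - t))" by (simp add: algebra_simps)
    moreover have "\<bar>t - r\<bar> = r - t" using r by simp
    ultimately show ?thesis
      using r by (intro that[of r]) auto
  qed
qed

text \<open>Tilt \<open>F\<close> by a small slope \<open>e\<close> and suppose that the tilted function \<open>P\<close> drops from \<open>a\<close> to
  \<open>b\<close>. Choose a level \<open>c\<close> in between which \<open>P\<close> does not take at any exceptional point; countability
  makes this possible. At the last point \<open>t\<close> where \<open>P\<close> is at least \<open>c\<close>, \<open>F\<close> cannot be
  differentiable, since \<open>P\<close> would not be smaller at some point further right. So \<open>t\<close> is
  exceptional and hence right-dense, and continuity gives \<open>P t = c\<close>, against the choice of \<open>c\<close>.\<close>

lemma pre_antiderivative_mono: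
  assumes F: "pre_antiderivative S f F" and "closed S" "a \<in> S" "b \<in> S" "a \<le> b"
    and nonneg: "\<And>t. t \<in> S \<Longrightarrow> a \<le> t \<Longrightarrow> t < b \<Longrightarrow> 0 \<le> f t"
  shows "F a \<le> F b"
proof -
  obtain D where D: "continuous_on S F" "D \<subseteq> kappa S" "countable (kappa S - D)"
    "\<forall>t\<in>kappa S - D. \<not> right_scattered S t" "\<forall>t\<in>D. has_delta_derivative F (f t) S t"
    using F by (auto simp: pre_antiderivative_def)
  have *: "F a + e * a \<le> F b + e * b" if "0 < e" for e
  proof (rule ccontr)
    define P where "P t = F t + e * t" for t
    assume "\<not> F a + e * a \<le> F b + e * b"
    then have "P b < P a" by (simp add: P_def)
    moreover have "countable (P ` (kappa S - D))" using D by simp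
    ultimately obtain c where c: "P b < c" "c < P a" "c \<notin> P ` (kappa S - D)"
      using real_interval_avoid_countable_set by (metis greaterThanLessThan_iff)
    have contP: "continuous_on S P"
      unfolding P_def using D by (intro continuous_intros)
    define K where "K = S \<inter> {a..b} \<inter> P -` {c..}"
    have "closed K"
      unfolding K_def using \<open>closed S\<close>
      by (intro continuous_closed_preimage continuous_on_subset[OF contP]) auto
    have bdd: "bdd_above K" by (rule bdd_aboveI[of _ b]) (auto simp: K_def)
    have "a \<in> K" using assms c by (auto simp: K_def)
    define t where "t = Sup K"
    have "t \<in> K"
      unfolding t_def using \<open>closed K\<close> bdd \<open>a \<in> K\<close> by (intro closed_contains_Sup) auto
    then have t: "t \<in> S" "a \<le> t" "t \<le> b" "c \<le> P t" by (auto simp: K_def)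
    have after: "P r < c" if "r \<in> S" "t < r" "r \<le> b" for r
    proof (rule ccontr)
      assume "\<not> P r < c"
      with that t have "r \<in> K" by (auto simp: K_def)
      then have "r \<le> t" unfolding t_def using bdd by (rule cSup_upper)
      with that show False by simp
    qed
    have "t < b" using t c by (cases "t = b") auto
    then have "t \<in> kappa S" using t \<open>b \<in> S\<close> kappa_if_not_max by blast
    have "t \<notin> D"
    proof
      assume "t \<in> D"
      then obtain r where r: "r \<in> S" "t < r" "r \<le> b" "F t - e * (r - t) \<le> F r"
        using has_delta_derivative_nonneg_step[OF \<open>closed S\<close> \<open>b \<in> S\<close> t(1) \<open>t < b\<close> _ _ \<open>0 < e\<close>]
          D(5) nonneg[OF t(1,2) \<open>t < b\<close>] by metis
      then have "P t \<le> P r" by (simp add: P_def algebra_simps)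
      with after[OF r(1-3)] t(4) show False by simp
    qed
    then have "\<not> right_scattered S t" "P t \<noteq> c" using D(4) \<open>t \<in> kappa S\<close> c(3) by auto
    then have "c < P t" using t by simp
    then obtain \<delta> where \<delta>: "0 < \<delta>" "\<And>s. s \<in> S \<Longrightarrow> dist s t < \<delta> \<Longrightarrow> dist (P s) (P t) < P t - c"
      using contP t(1) unfolding continuous_on_iff by (metis diff_gt_0_iff_gt)
    obtain r where r: "r \<in> S" "t < r" "r < t + \<delta>" "r \<le> b"
      using right_dense_approx[OF \<open>closed S\<close> \<open>b \<in> S\<close> \<open>t < b\<close> \<open>\<not> right_scattered S t\<close> \<delta>(1)] by blast
    have "dist (P r) (P t) < P t - c" using r \<delta>(2)[of r] by (simp add: dist_real_def)
    with after[OF r(1,2,4)] show False by (simp add: dist_real_def)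
  qed
  show ?thesis
  proof (cases "a = b")
    case False
    show ?thesis
    proof (rule field_le_epsilon)
      fix e :: real assume "0 < e"
      then have "0 < e / (b - a)" using False \<open>a \<le> b\<close> by simp
      have "F a \<le> F b + e / (b - a) * (b - a)"
        using *[OF \<open>0 < e / (b - a)\<close>] by (simp only: right_diff_distrib)
      then show "F a \<le> F b + e" using False by simp
    qed
  qed simp
qed

lemma pre_antiderivative_le:
  assumes "pre_antiderivative S f F" "pre_antiderivative S g G" "closed S" "a \<in> S" "b \<in> S" "a \<le> b"
    and "\<And>t. t \<in> S \<Longrightarrow> a \<le> t \<Longrightarrow> t < b \<Longrightarrow> f t \<le> g t"
  shows "F b - F a \<le> G b - G a"
  using pre_antiderivative_mono[OF pre_antiderivative_lincomb[OF assms(2,1), of 1 "-1"] assms(3-6)]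
    assms(7) by simp

lemma delta_integral_eq:
  assumes "closed T" "a \<in> T" "b \<in> T" "pre_antiderivative (T \<inter> {min a b..max a b}) f F"
  shows "delta_integral T a b f = F b - F a"
proof -
  let ?S = "T \<inter> {min a b..max a b}"
  define F' where "F' = (SOME F. pre_antiderivative ?S f F)"
  have F': "pre_antiderivative ?S f F'"
    unfolding F'_def using assms(4) by (rule someI[where P = "pre_antiderivative ?S f"])
  have S: "closed ?S" "min a b \<in> ?S" "max a b \<in> ?S" "min a b \<le> max a b"
    using assms by (auto simp: min_def max_def)
  have "F' (max a b) - F' (min a b) = F (max a b) - F (min a b)"
    using pre_antiderivative_le[OF F' assms(4) S] pre_antiderivative_le[OF assms(4) F' S] by simp
  then have "F' b - F' a = F b - F a" by (auto simp: min_def max_def split: if_splits)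
  then show ?thesis
    using assms(4) by (auto simp: delta_integral_def Let_def F'_def)
qed

section \<open>Products with a continuous function\<close>

text \<open>A generalised inverse of a nondecreasing \<open>G\<close> on \<open>S\<close>. In a gap between \<open>t\<close> and its forward
  jump \<open>\<sigma>\<close>, all levels in \<open>(G t, G \<sigma>]\<close> are sent to the left end \<open>t\<close>, as the delta integral
  requires. Inserting \<open>a\<close>, the minimum of \<open>S\<close>, keeps the set nonempty at low levels, so that the
  function is nondecreasing on the whole line.\<close>

definition last_below_level :: "real set \<Rightarrow> (real \<Rightarrow> real) \<Rightarrow> real \<Rightarrow> real \<Rightarrow> real" where
  "last_below_level S G a u = Sup (insert a {r \<in> S. G r < u})"

context
  fixes S :: "real set" and G :: "real \<Rightarrow> real" and a b :: real
  assumes closed: "closed S" and ab: "a \<in> S" "b \<in> S" "S \<subseteq> {a..b}"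
    and G_mono: "mono_on S G"
begin

lemma last_below_level_bdd: "bdd_above (insert a {r \<in> S. G r < u})"
  using ab by (intro bdd_aboveI[of _ b]) auto

lemma last_below_level_in: "last_below_level S G a u \<in> S"
proof -
  have "Sup (insert a {r \<in> S. G r < u}) \<in> closure (insert a {r \<in> S. G r < u})"
    by (intro closure_contains_Sup last_below_level_bdd) auto
  also have "\<dots> \<subseteq> S" using closed ab by (intro closure_minimal) auto
  finally show ?thesis by (simp add: last_below_level_def)
qed

lemma mono_last_below_level: "mono (last_below_level S G a)"
  unfolding last_below_level_def
  by (intro monoI cSup_subset_mono last_below_level_bdd) auto

lemma last_below_level_ge:
  assumes "s \<in> S" "G s < u"
  shows "s \<le> last_below_level S G a u"
  unfolding last_below_level_def using assms by (intro cSup_upper last_below_level_bdd) auto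

lemma last_below_level_le:
  assumes "s \<in> S" "u \<le> G s"
  shows "last_below_level S G a u \<le> s"
  unfolding last_below_level_def
proof (rule cSup_least)
  fix r assume "r \<in> insert a {r \<in> S. G r < u}"
  then show "r \<le> s"
    using assms ab mono_onD[OF G_mono, of s r] by (cases "r \<le> s") auto
qed simp

lemma last_below_level_le_jump:
  assumes "t \<in> S" "u \<le> G (fwd_jump S t)"
  shows "last_below_level S G a u \<le> t"
  unfolding last_below_level_def
proof (rule cSup_least)
  have jump: "fwd_jump S t \<in> S" using closed assms by (intro fwd_jump_in)
  fix r assume "r \<in> insert a {r \<in> S. G r < u}"
  then consider "r = a" | "r \<in> S" "G r < u" by auto
  then show "r \<le> t"
  proof cases
    case 2
    then have "r < fwd_jump S t"
      using assms jump mono_onD[OF G_mono, of "fwd_jump S t" r] by (cases "r < fwd_jump S t") auto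
    then show ?thesis
      using fwd_jump_greater(3)[OF closed 2(1), of t] by (cases "r \<le> t") auto
  qed (use assms ab in auto)
qed simp

definition stieltjes_integral :: "(real \<Rightarrow> real) \<Rightarrow> real \<Rightarrow> real" where
  "stieltjes_integral f t = integral {G a..G t} (\<lambda>u. f (last_below_level S G a u))"

text \<open>Measurability comes from the monotonicity of the generalised inverse, after extending \<open>f\<close>
  continuously to the line.\<close>

lemma integrable_last_below_level:
  fixes f :: "real \<Rightarrow> real"
  assumes "continuous_on S f"
  shows "(\<lambda>u. f (last_below_level S G a u)) integrable_on {p..q}"
proof -
  have "closedin (top_of_set UNIV) S" using closed by simp
  from Tietze_unbounded[OF assms this] obtain h
    where h: "continuous_on UNIV h" "\<And>x. x \<in> S \<Longrightarrow> h x = f x" by blast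
  have "compact S"
    using closed ab bounded_subset[OF bounded_closed_interval] compact_eq_bounded_closed by blast
  then have "bounded (f ` S)"
    using assms compact_continuous_image compact_imp_bounded by blast
  then obtain B where B: "\<And>x. x \<in> S \<Longrightarrow> \<bar>f x\<bar> \<le> B"
    unfolding bounded_real by auto
  have "(\<lambda>u. h (last_below_level S G a u)) \<in> borel_measurable borel"
    using h(1) borel_measurable_mono[OF mono_last_below_level]
    by (rule borel_measurable_continuous_on)
  then have "(\<lambda>u. f (last_below_level S G a u)) \<in> borel_measurable borel"
    using h(2) last_below_level_in by simp
  then have "(\<lambda>u. f (last_below_level S G a u)) \<in> borel_measurable (lebesgue_on {p..q})"
    by (intro measurable_restrict_space1 measurable_completion) simp
  then show ?thesis
    using B last_below_level_in
    by (rule_tac measurable_bounded_by_integrable_imp_integrable_real[where g = "\<lambda>_. B"]) auto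
qed

text \<open>The level \<open>G s\<close> itself may be sent to the left of \<open>s\<close>, so it has to be left out; one point does
  not matter to the integral.\<close>

lemma stieltjes_integral_bound:
  assumes f: "continuous_on S f" and "s \<in> S" "t \<in> S" "s \<le> t" "0 \<le> e"
    and bound: "\<And>u. G s < u \<Longrightarrow> u \<le> G t \<Longrightarrow> \<bar>f (last_below_level S G a u) - c\<bar> \<le> e"
  shows "\<bar>stieltjes_integral f t - stieltjes_integral f s - c * (G t - G s)\<bar> \<le> e * (G t - G s)"
proof -
  let ?h = "\<lambda>u. f (last_below_level S G a u)"
  have G: "G a \<le> G s" "G s \<le> G t"
    using assms ab mono_onD[OF G_mono] by auto
  have "integral {G a..G s} ?h + integral {G s..G t} ?h = integral {G a..G t} ?h"
    using G integrable_last_below_level[OF f] by (intro Henstock_Kurzweil_Integration.integral_combine)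
  then have diff: "stieltjes_integral f t - stieltjes_integral f s = integral {G s..G t} ?h"
    by (simp add: stieltjes_integral_def)
  have "(?h has_integral integral {G s..G t} ?h) {G s..G t}"
    using integrable_last_below_level[OF f] by (rule integrable_integral)
  moreover have "((\<lambda>_. c) has_integral (G t - G s) * c) {G s..G t}"
    using has_integral_const_real[of c "G s" "G t"] G by simp
  ultimately have "((\<lambda>u. ?h u - c) has_integral (integral {G s..G t} ?h - (G t - G s) * c)) (cbox (G s) (G t))"
    unfolding cbox_interval by (rule has_integral_diff)
  then have "norm (integral {G s..G t} ?h - (G t - G s) * c) \<le> e * measure lborel (cbox (G s) (G t))"
    using bound \<open>0 \<le> e\<close> by (rule_tac S = "{G s}" in has_integral_bound_spike_finite) force+
  then show ?thesis using G by (simp add: diff mult.commute)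
qed

lemma continuous_on_stieltjes_integral:
  assumes f: "continuous_on S f" and G: "continuous_on S G"
  shows "continuous_on S (stieltjes_integral f)"
proof -
  have "compact S"
    using closed ab bounded_subset[OF bounded_closed_interval] compact_eq_bounded_closed by blast
  then have "bounded (f ` S)"
    using f compact_continuous_image compact_imp_bounded by blast
  then obtain B where B: "0 < B" "\<And>x. x \<in> S \<Longrightarrow> \<bar>f x\<bar> \<le> B"
    unfolding bounded_pos by auto
  have le: "\<bar>stieltjes_integral f t - stieltjes_integral f s\<bar> \<le> B * \<bar>G t - G s\<bar>"
    if "s \<in> S" "t \<in> S" "s \<le> t" for s t
  proof -
    have "\<bar>stieltjes_integral f t - stieltjes_integral f s - 0 * (G t - G s)\<bar> \<le> B * (G t - G s)"
      using B last_below_level_in that by (intro stieltjes_integral_bound f) auto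
    moreover have "G s \<le> G t" using that mono_onD[OF G_mono] by auto
    ultimately show ?thesis by simp
  qed
  have lip: "dist (stieltjes_integral f t) (stieltjes_integral f s) \<le> B * dist (G t) (G s)"
    if "s \<in> S" "t \<in> S" for s t
    using le[of s t] le[of t s] that by (cases "s \<le> t") (auto simp: dist_real_def abs_minus_commute)
  show ?thesis
    unfolding continuous_on_iff
  proof (intro ballI allI impI)
    fix t and e :: real assume "t \<in> S" "0 < e"
    then have "0 < e / B" using B by simp
    then obtain \<delta> where \<delta>: "0 < \<delta>" "\<And>s. s \<in> S \<Longrightarrow> dist s t < \<delta> \<Longrightarrow> dist (G s) (G t) < e / B"
      using G \<open>t \<in> S\<close> unfolding continuous_on_iff by meson
    show "\<exists>d>0. \<forall>s\<in>S. dist s t < d \<longrightarrow>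
        dist (stieltjes_integral f s) (stieltjes_integral f t) < e"
    proof (intro exI conjI ballI impI)
      fix s assume s: "s \<in> S" "dist s t < \<delta>"
      have "B * dist (G s) (G t) < B * (e / B)"
        using \<delta>(2)[OF s] B by (intro mult_strict_left_mono)
      with lip[OF \<open>t \<in> S\<close> s(1)] B
      show "dist (stieltjes_integral f s) (stieltjes_integral f t) < e" by simp
    qed (fact \<delta>(1))
  qed
qed

text \<open>For \<open>s\<close> close to \<open>t\<close>, the levels between \<open>G s\<close> and \<open>G\<close> of the forward jump of \<open>t\<close> are sent to
  points between \<open>s\<close> and \<open>t\<close>, never into or beyond the gap to the right of \<open>t\<close>; there \<open>f\<close> is
  almost \<open>f t\<close>. So increments of the Stieltjes integral are almost \<open>f t\<close> times those of \<open>G\<close>.\<close>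

lemma stieltjes_integral_increment:
  assumes f: "continuous_on S f" and t: "t \<in> S" and "0 < e"
  obtains \<delta> where "0 < \<delta>"
    "\<And>s. s \<in> S \<Longrightarrow> \<bar>s - t\<bar> < \<delta> \<Longrightarrow>
       \<bar>stieltjes_integral f (fwd_jump S t) - stieltjes_integral f s - f t * (G (fwd_jump S t) - G s)\<bar>
         \<le> e * \<bar>G (fwd_jump S t) - G s\<bar>"
proof -
  let ?\<sigma> = "fwd_jump S t"
  obtain \<delta>0 where \<delta>0: "0 < \<delta>0" "\<And>s. s \<in> S \<Longrightarrow> dist s t < \<delta>0 \<Longrightarrow> dist (f s) (f t) < e"
    using f t \<open>0 < e\<close> unfolding continuous_on_iff by meson
  \<comment> \<open>small enough to exclude points of \<open>S\<close> to the right of a right-scattered \<open>t\<close>\<close>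
  define \<delta> where "\<delta> = (if right_scattered S t then min \<delta>0 (?\<sigma> - t) else \<delta>0)"
  have "0 < \<delta>" using \<delta>0 by (auto simp: \<delta>_def right_scattered_def)
  have \<sigma>: "?\<sigma> \<in> S" "t \<le> ?\<sigma>" using closed t fwd_jump_in fwd_jump_ge by auto
  have near: "\<bar>f (last_below_level S G a u) - f t\<bar> \<le> e"
    if "\<bar>s - t\<bar> < \<delta>" "\<bar>last_below_level S G a u - t\<bar> \<le> \<bar>s - t\<bar>" for s u
    using \<delta>0(2)[OF last_below_level_in, of u] that
    by (auto simp: dist_real_def \<delta>_def split: if_splits)
  show thesis
  proof (rule that[OF \<open>0 < \<delta>\<close>])
    fix s assume s: "s \<in> S" "\<bar>s - t\<bar> < \<delta>"
    show "\<bar>stieltjes_integral f ?\<sigma> - stieltjes_integral f s - f t * (G ?\<sigma> - G s)\<bar>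
        \<le> e * \<bar>G ?\<sigma> - G s\<bar>"
    proof (cases "s \<le> t")
      case True
      then have "G s \<le> G ?\<sigma>" using \<sigma> s mono_onD[OF G_mono] by auto
      moreover have "\<bar>stieltjes_integral f ?\<sigma> - stieltjes_integral f s - f t * (G ?\<sigma> - G s)\<bar>
          \<le> e * (G ?\<sigma> - G s)"
      proof (intro stieltjes_integral_bound f)
        fix u assume "G s < u" "u \<le> G ?\<sigma>"
        then have "s \<le> last_below_level S G a u" "last_below_level S G a u \<le> t"
          using last_below_level_ge last_below_level_le_jump s t by auto
        then show "\<bar>f (last_below_level S G a u) - f t\<bar> \<le> e"
          using True by (intro near[OF s(2)]) auto
      qed (use s \<sigma> True \<open>0 < e\<close> in auto)
      ultimately show ?thesis by simp
    next
      case False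
      then have \<sigma>t: "?\<sigma> = t"
        using fwd_jump_greater(3)[OF closed s(1), of t] s(2) \<sigma>
        by (auto simp: \<delta>_def right_scattered_def split: if_splits)
      have "G t \<le> G s" using False t s mono_onD[OF G_mono] by auto
      moreover have "\<bar>stieltjes_integral f s - stieltjes_integral f t - f t * (G s - G t)\<bar>
          \<le> e * (G s - G t)"
      proof (intro stieltjes_integral_bound f)
        fix u assume "G t < u" "u \<le> G s"
        then have "t \<le> last_below_level S G a u" "last_below_level S G a u \<le> s"
          using last_below_level_ge last_below_level_le s t by auto
        then show "\<bar>f (last_below_level S G a u) - f t\<bar> \<le> e"
          using False by (intro near[OF s(2)]) auto
      qed (use s t False \<open>0 < e\<close> in auto)
      moreover have "stieltjes_integral f t - stieltjes_integral f s - f t * (G t - G s)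
          = - (stieltjes_integral f s - stieltjes_integral f t - f t * (G s - G t))"
        by (simp add: algebra_simps)
      ultimately show ?thesis unfolding \<sigma>t by simp
    qed
  qed
qed

lemma has_delta_derivative_stieltjes_integral:
  assumes f: "continuous_on S f" and t: "t \<in> S" and G: "has_delta_derivative G d S t"
  shows "has_delta_derivative (stieltjes_integral f) (f t * d) S t"
  unfolding has_delta_derivative_def
proof (intro allI impI)
  let ?\<sigma> = "fwd_jump S t" and ?H = "stieltjes_integral f"
  fix e :: real assume "0 < e"
  \<comment> \<open>\<open>q \<le> 1\<close> makes \<open>G\<close> Lipschitz at \<open>t\<close> with constant \<open>\<bar>d\<bar> + 1\<close>, for which \<open>p\<close> compensates.\<close>
  define p where "p = e / (2 * (\<bar>d\<bar> + 1))"
  define q where "q = min 1 (e / (2 * (\<bar>f t\<bar> + 1)))"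
  have pq: "0 < p" "0 < q" using \<open>0 < e\<close> by (auto simp: p_def q_def)
  obtain \<delta>1 where \<delta>1: "0 < \<delta>1"
    "\<And>s. s \<in> S \<Longrightarrow> \<bar>s - t\<bar> < \<delta>1 \<Longrightarrow> \<bar>?H ?\<sigma> - ?H s - f t * (G ?\<sigma> - G s)\<bar> \<le> p * \<bar>G ?\<sigma> - G s\<bar>"
    using stieltjes_integral_increment[OF f t pq(1)] by blast
  obtain \<delta>2 where \<delta>2: "0 < \<delta>2"
    "\<And>s. s \<in> S \<Longrightarrow> \<bar>s - t\<bar> < \<delta>2 \<Longrightarrow> \<bar>G ?\<sigma> - G s - d * (?\<sigma> - s)\<bar> \<le> q * \<bar>?\<sigma> - s\<bar>"
    using G pq(2) unfolding has_delta_derivative_def by meson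
  show "\<exists>\<delta>>0. \<forall>s\<in>S. \<bar>s - t\<bar> < \<delta> \<longrightarrow> \<bar>?H ?\<sigma> - ?H s - f t * d * (?\<sigma> - s)\<bar> \<le> e * \<bar>?\<sigma> - s\<bar>"
  proof (intro exI conjI ballI impI)
    fix s assume s: "s \<in> S" "\<bar>s - t\<bar> < min \<delta>1 \<delta>2"
    let ?x = "\<bar>?\<sigma> - s\<bar>" and ?r = "G ?\<sigma> - G s - d * (?\<sigma> - s)"
    have r: "\<bar>?r\<bar> \<le> q * ?x" using \<delta>2(2)[of s] s by simp
    have "\<bar>G ?\<sigma> - G s\<bar> \<le> \<bar>?r\<bar> + \<bar>d * (?\<sigma> - s)\<bar>" by simp
    also have "\<dots> \<le> 1 * ?x + \<bar>d\<bar> * ?x"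
      using order_trans[OF r mult_right_mono[of q 1 ?x]] by (simp add: q_def abs_mult)
    finally have "\<bar>G ?\<sigma> - G s\<bar> \<le> (\<bar>d\<bar> + 1) * ?x" by (simp add: algebra_simps)
    then have "p * \<bar>G ?\<sigma> - G s\<bar> \<le> p * ((\<bar>d\<bar> + 1) * ?x)"
      using pq by (intro mult_left_mono) auto
    also have "\<dots> = e / 2 * ?x"
      by (simp add: p_def field_simps)
    finally have 1: "\<bar>?H ?\<sigma> - ?H s - f t * (G ?\<sigma> - G s)\<bar> \<le> e / 2 * ?x"
      using \<delta>1(2)[of s] s by simp
    have "\<bar>f t * ?r\<bar> \<le> (\<bar>f t\<bar> + 1) * (q * ?x)"
      unfolding abs_mult using r by (intro mult_mono) auto
    also have "\<dots> \<le> (\<bar>f t\<bar> + 1) * (e / (2 * (\<bar>f t\<bar> + 1)) * ?x)"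
      by (intro mult_left_mono mult_right_mono) (auto simp: q_def)
    also have "\<dots> = e / 2 * ?x"
      by (simp add: field_simps)
    finally have 2: "\<bar>f t * ?r\<bar> \<le> e / 2 * ?x" .
    have "?H ?\<sigma> - ?H s - f t * d * (?\<sigma> - s)
        = (?H ?\<sigma> - ?H s - f t * (G ?\<sigma> - G s)) + f t * ?r"
      by (simp add: algebra_simps)
    then show "\<bar>?H ?\<sigma> - ?H s - f t * d * (?\<sigma> - s)\<bar> \<le> e * ?x"
      using 1 2 by linarith
  qed (use \<delta>1 \<delta>2 in simp)
qed

end

lemma pre_antiderivative_times_continuous:
  assumes G: "pre_antiderivative S g G" and "closed S" "a \<in> S" "b \<in> S" "S \<subseteq> {a..b}"
    and nonneg: "\<And>t. t \<in> S \<Longrightarrow> 0 \<le> g t" and f: "continuous_on S f"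
  shows "\<exists>H. pre_antiderivative S (\<lambda>t. f t * g t) H"
proof -
  have "mono_on S G"
    using pre_antiderivative_mono[OF G \<open>closed S\<close>] nonneg by (intro mono_onI) blast
  note S = \<open>closed S\<close> \<open>a \<in> S\<close> \<open>b \<in> S\<close> \<open>S \<subseteq> {a..b}\<close> this
  obtain D where D: "continuous_on S G" "D \<subseteq> kappa S" "countable (kappa S - D)"
    "\<forall>t\<in>kappa S - D. \<not> right_scattered S t" "\<forall>t\<in>D. has_delta_derivative G (g t) S t"
    using G by (auto simp: pre_antiderivative_def)
  have "D \<subseteq> S" using D by (auto simp: kappa_def)
  have "pre_antiderivative S (\<lambda>t. f t * g t) (stieltjes_integral S G a f)"
    unfolding pre_antiderivative_def
  proof (intro conjI exI)
    show "continuous_on S (stieltjes_integral S G a f)"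
      using continuous_on_stieltjes_integral[OF S f D(1)] .
    show "\<forall>t\<in>D. has_delta_derivative (stieltjes_integral S G a f) (f t * g t) S t"
      using has_delta_derivative_stieltjes_integral[OF S f] D(5) \<open>D \<subseteq> S\<close> by blast
  qed (use D in auto)
  then show ?thesis by blast
qed

section \<open>Convex functions and affine functions\<close>

text \<open>In the interior a supporting line is exact. At an endpoint the one-sided slope may be infinite,
  as for \<open>\<lambda>t. - sqrt t\<close> at \<open>0\<close>; then continuity and a sufficiently steep line still give
  any precision.\<close>

lemma convex_on_approx_affine_minorant:
  fixes f :: "real \<Rightarrow> real"
  assumes "continuous_on {a..b} f" "convex_on {a..b} f" "x \<in> {a..b}" "0 < e"
  obtains m where "\<And>t. t \<in> {a..b} \<Longrightarrow> f x - e + m * (t - x) \<le> f t"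
proof (cases "a < x \<and> x < b")
  case True
  then have "x \<in> interior {a..b}" by (simp add: interior_atLeastAtMost_real)
  define m where "m = Inf ((\<lambda>t. (f x - f t) / (x - t)) ` ({x<..} \<inter> {a..b}))"
  have "f x - e + m * (t - x) \<le> f t" if "t \<in> {a..b}" for t
    using convex_le_Inf_differential[OF assms(2) \<open>x \<in> interior {a..b}\<close> that] \<open>0 < e\<close>
    by (simp add: m_def)
  then show ?thesis by (rule that)
next
  case False
  then consider "x = a" | "x = b" using assms by force
  then obtain k where k: "\<And>t. t \<in> {a..b} \<Longrightarrow> \<bar>t - x\<bar> = k * (t - x)"
  proof cases
    case 1
    then show ?thesis by (intro that[of 1]) auto
  next
    case 2
    then show ?thesis by (intro that[of "-1"]) auto
  qed
  obtain \<delta> where \<delta>: "0 < \<delta>" "\<And>t. t \<in> {a..b} \<Longrightarrow> dist t x < \<delta> \<Longrightarrow> dist (f t) (f x) < e"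
    using assms(1,3,4) unfolding continuous_on_iff by meson
  obtain y where y: "\<And>t. t \<in> {a..b} \<Longrightarrow> f y \<le> f t" "y \<in> {a..b}"
    using continuous_attains_inf[OF compact_Icc _ assms(1)] assms(3) by blast
  \<comment> \<open>steep enough to fall below the minimum of \<open>f\<close> at distance \<open>\<delta>\<close>\<close>
  define K where "K = (f x - f y) / \<delta>"
  have "0 \<le> K" using \<delta> y assms by (simp add: K_def)
  have "f x - e + (- K * k) * (t - x) \<le> f t" if t: "t \<in> {a..b}" for t
  proof -
    have eq: "(- K * k) * (t - x) = - (K * \<bar>t - x\<bar>)" using k[OF t] by simp
    show ?thesis
    proof (cases "\<bar>t - x\<bar> < \<delta>")
      case True
      then have "f x - e < f t" using \<delta>(2)[OF t] by (simp add: dist_real_def)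
      moreover have "0 \<le> K * \<bar>t - x\<bar>" using \<open>0 \<le> K\<close> by simp
      ultimately show ?thesis unfolding eq by linarith
    next
      case False
      then have "K * \<delta> \<le> K * \<bar>t - x\<bar>" using \<open>0 \<le> K\<close> by (intro mult_left_mono) auto
      moreover have "K * \<delta> = f x - f y" using \<delta> by (simp add: K_def)
      ultimately show ?thesis unfolding eq using y(1)[OF t] \<open>0 < e\<close> by linarith
    qed
  qed
  then show ?thesis by (rule that)
qed

lemma convex_on_le_chord:
  fixes f :: "real \<Rightarrow> real"
  assumes "convex_on {a..b} f" "a < b" "t \<in> {a..b}"
  shows "f t \<le> (b - t) / (b - a) * f a + (t - a) / (b - a) * f b"
proof -
  have "f t \<le> (f b - f a) / (b - a) * (t - a) + f a"
    using assms by (intro convex_onD_Icc') auto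
  also have "\<dots> = (b - t) / (b - a) * f a + (t - a) / (b - a) * f b"
  proof -
    have "(b - t) / (b - a) = 1 - (t - a) / (b - a)" using assms by (simp add: field_simps)
    then show ?thesis by (simp add: algebra_simps diff_divide_distrib)
  qed
  finally show ?thesis .
qed

section \<open>The weighted Hermite-Hadamard inequality\<close>

lemma frac_weight_nonneg: "0 \<le> frac_weight \<alpha> t"
  by (simp add: frac_weight_def)

text \<open>If the integral of \<open>g\<close> is \<open>W\<close> and the one of \<open>t g\<close> is \<open>x W\<close>, then the affine function \<open>p + q t\<close>
  integrates to \<open>(p + q x) W\<close>. The bounds thus come from comparing \<open>f\<close> with affine functions,
  and so does \<open>a \<le> x \<le> b\<close>, by comparing \<open>t\<close> with the constants \<open>a\<close> and \<open>b\<close>.\<close>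

lemma weighted_Hermite_Hadamard:
  fixes f g :: "real \<Rightarrow> real"
  assumes "closed S" "a \<in> S" "b \<in> S" "S \<subseteq> {a..b}" "a < b"
    and f: "continuous_on {a..b} f" "convex_on {a..b} f"
    and nonneg: "\<And>t. t \<in> S \<Longrightarrow> 0 \<le> g t"
    and G: "pre_antiderivative S g G" and X: "pre_antiderivative S (\<lambda>t. t * g t) X"
    and H: "pre_antiderivative S (\<lambda>t. f t * g t) H"
    and W: "0 < G b - G a" and x: "X b - X a = x * (G b - G a)"
  shows "f x * (G b - G a) \<le> H b - H a"
    and "H b - H a \<le> ((b - x) / (b - a) * f a + (x - a) / (b - a) * f b) * (G b - G a)"
proof -
  let ?W = "G b - G a"
  have affine: "(p * G b + q * X b) - (p * G a + q * X a) = (p + q * x) * ?W" for p q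
  proof -
    have "(p * G b + q * X b) - (p * G a + q * X a) = p * ?W + q * (X b - X a)"
      by (simp add: algebra_simps)
    then show ?thesis unfolding x by (simp add: algebra_simps)
  qed
  note A = pre_antiderivative_lincomb[OF G X]
  have S: "closed S" "a \<in> S" "b \<in> S" "a \<le> b" using assms by auto
  have le_H: "(p + q * x) * ?W \<le> H b - H a"
    if "\<And>t. t \<in> {a..b} \<Longrightarrow> p + q * t \<le> f t" for p q
    unfolding affine[symmetric]
  proof (rule pre_antiderivative_le[OF A H S])
    fix t assume "t \<in> S"
    then have "(p + q * t) * g t \<le> f t * g t"
      using that \<open>S \<subseteq> {a..b}\<close> nonneg by (intro mult_right_mono) auto
    then show "p * g t + q * (t * g t) \<le> f t * g t" by (simp add: algebra_simps)
  qed
  have H_le: "H b - H a \<le> (p + q * x) * ?W"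
    if "\<And>t. t \<in> {a..b} \<Longrightarrow> f t \<le> p + q * t" for p q
    unfolding affine[symmetric]
  proof (rule pre_antiderivative_le[OF H A S])
    fix t assume "t \<in> S"
    then have "f t * g t \<le> (p + q * t) * g t"
      using that \<open>S \<subseteq> {a..b}\<close> nonneg by (intro mult_right_mono) auto
    then show "f t * g t \<le> p * g t + q * (t * g t)" by (simp add: algebra_simps)
  qed
  have "a * ?W \<le> x * ?W"
    using pre_antiderivative_le[OF A X S, of a 0] nonneg x
    by (simp add: mult_right_mono right_diff_distrib)
  moreover have "x * ?W \<le> b * ?W"
    using pre_antiderivative_le[OF X A S, of b 0] nonneg x
    by (simp add: mult_right_mono right_diff_distrib)
  ultimately have x_in: "x \<in> {a..b}" using W by simp
  show "f x * ?W \<le> H b - H a"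
  proof (rule field_le_epsilon)
    fix e :: real assume "0 < e"
    then have "0 < e / ?W" using W by simp
    from convex_on_approx_affine_minorant[OF f x_in this] obtain m
      where m: "\<And>t. t \<in> {a..b} \<Longrightarrow> f x - e / ?W + m * (t - x) \<le> f t" by blast
    have "(f x - e / ?W - m * x + m * x) * ?W \<le> H b - H a"
      using m by (intro le_H) (simp add: algebra_simps)
    then show "f x * ?W \<le> H b - H a + e"
      using W by (simp add: left_diff_distrib)
  qed
  define p where "p = (b * f a - a * f b) / (b - a)"
  define q where "q = (f b - f a) / (b - a)"
  have chord: "(b - t) / (b - a) * f a + (t - a) / (b - a) * f b = p + q * t" for t
    using \<open>a < b\<close> by (simp add: p_def q_def field_simps)
  show "H b - H a \<le> ((b - x) / (b - a) * f a + (x - a) / (b - a) * f b) * ?W"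
    unfolding chord using convex_on_le_chord[OF f(2) \<open>a < b\<close>, unfolded chord] by (rule H_le)
qed

theorem theorem12:
  fixes T :: "real set" and a b \<alpha> :: real and f w :: "real \<Rightarrow> real"
  assumes "time_scale T" and "a \<in> T" and "b \<in> T"
    and "0 < \<alpha>" and "\<alpha> \<le> 1"
    and "continuous_on {a..b} f" and "convex_on {a..b} f"
    and "continuous_on T w" and "\<forall>t\<in>T. 0 \<le> w t"
    and "0 < frac_integral T \<alpha> a b w"
  shows "let x = frac_integral T \<alpha> a b (\<lambda>t. t * w t) / frac_integral T \<alpha> a b w in
    f x \<le> 1 / frac_integral T \<alpha> a b w * frac_integral T \<alpha> a b (\<lambda>t. f t * w t) \<and>
    1 / frac_integral T \<alpha> a b w * frac_integral T \<alpha> a b (\<lambda>t. f t * w t)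
      \<le> (b - x) / (b - a) * f a + (x - a) / (b - a) * f b"
proof -
  define S where "S = T \<inter> {min a b..max a b}"
  define g where "g t = w t * frac_weight \<alpha> t" for t
  have T: "closed T" using assms by (simp add: time_scale_def)
  then have closed: "closed S" by (auto simp: S_def)
  have nonneg: "0 \<le> g t" if "t \<in> S" for t
    using that assms frac_weight_nonneg by (auto simp: S_def g_def)
  have int_w: "frac_integral T \<alpha> a b w = delta_integral T a b g"
    by (simp add: frac_integral_def g_def[abs_def])
  have int_hw: "frac_integral T \<alpha> a b (\<lambda>t. h t * w t) = delta_integral T a b (\<lambda>t. h t * g t)" for h
    by (simp add: frac_integral_def g_def mult.assoc)
  have "\<exists>G. pre_antiderivative S g G"
  proof (rule ccontr)
    assume "\<not> ?thesis"
    then have "delta_integral T a b g = 0"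
      by (auto simp: delta_integral_def Let_def S_def)
    with assms int_w show False by simp
  qed
  then obtain G where G: "pre_antiderivative S g G" ..
  note eval = delta_integral_eq[OF T assms(2,3), folded S_def]
  have W: "0 < G b - G a" using eval[OF G] int_w assms by simp
  have "a < b"
  proof (rule ccontr)
    assume "\<not> a < b"
    then have "G b \<le> G a"
      using nonneg assms by (intro pre_antiderivative_mono[OF G closed]) (auto simp: S_def)
    with W show False by simp
  qed
  then have S: "a \<in> S" "b \<in> S" "S \<subseteq> {a..b}" using assms by (auto simp: S_def)
  note product = pre_antiderivative_times_continuous[OF G closed S nonneg]
  obtain X where X: "pre_antiderivative S (\<lambda>t. t * g t) X"
    using product[OF _ continuous_on_id] by blast
  obtain H where H: "pre_antiderivative S (\<lambda>t. f t * g t) H"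
    using product[OF _ continuous_on_subset[OF assms(6) S(3)]] by blast
  define x where "x = (X b - X a) / (G b - G a)"
  have x: "X b - X a = x * (G b - G a)" using W by (simp add: x_def)
  note bounds = weighted_Hermite_Hadamard[OF closed S \<open>a < b\<close> assms(6,7) nonneg G X H W x]
  have "f x \<le> 1 / (G b - G a) * (H b - H a)"
    "1 / (G b - G a) * (H b - H a) \<le> (b - x) / (b - a) * f a + (x - a) / (b - a) * f b"
    using bounds W by (auto simp: pos_le_divide_eq pos_divide_le_eq)
  then show ?thesis
    unfolding int_w int_hw eval[OF G] eval[OF X] eval[OF H] Let_def x_def[symmetric] by simp
qed

end
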